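(* Let $a,b\in\mathbb{N}$ with $a\le b$, let $\Omega=\{1,\ldots,a\}\times\{1,\ldots,b\}$ and let $\mathcal{C}_0=\mathcal{C}_0(a,b)$. \begin{enumerate} \item[(1)] If $1=a\le b$, then $\operatorname{Aut}(\mathcal{C}_0)=\operatorname{Sym}(\Omega)\cong\operatorname{Sym}(b)$. \item[(2)] If $2=a=b$, then $\operatorname{Aut}(\mathcal{C}_0)=\operatorname{Sym}(\Omega)\cong\operatorname{Sym}(4)$. \item[(3)] If $2=a<b$, then $\operatorname{Aut}(\mathcal{C}_0)=C_2\wr\operatorname{Sym}(b)$. \item[(4)] If $2<a=b$, then $\operatorname{Aut}(\mathcal{C}_0)=\operatorname{Sym}(a)\wr C_2$. \item[(5)] If $2<a<b$, then $\operatorname{Aut}(\mathcal{C}_0)=\operatorname{Sym}(a)\times\operatorname{Sym}(b)$. \end{enumerate}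
   Context: $\mathbb{N}$ denotes the positive integers. For $a,b\in\mathbb{N}$ with $a\le b$, let $\Omega=\{1,\ldots,a\}\times\{1,\ldots,b\}$ and let $\mathcal{V}=\operatorname{Mat}(a,b,\mathbb{F}_2)$ be the $\mathbb{F}_2$-vector space of $a\times b$ matrices, with standard basis the elementary matrices $\mathbf{e}_{ij}$, $(i,j)\in\Omega$. Define $\mathbf{r}_i=\sum_{j=1}^b\mathbf{e}_{ij}$ ($1\le i\le a$) and $\mathbf{c}_j=\sum_{i=1}^a\mathbf{e}_{ij}$ ($1\le j\le b$), and let $\mathcal{C}_0(a,b)\le\mathcal{V}$ be the $\mathbb{F}_2$-span of $\{\mathbf{r}_1,\ldots,\mathbf{r}_a,\mathbf{c}_1,\ldots,\mathbf{c}_b\}$. For a subspace $\mathcal{C}\le\mathcal{V}$, $\operatorname{Aut}(\mathcal{C})\le\operatorname{Sym}(\Omega)$ is the group of all permutations of $\Omega$ whose induced permutation of the standard basis maps $\mathcal{C}$ into itself. The groups on the right-hand sides are subgroups of $\operatorname{Sym}(\Omega)$ via the following (right) actions on $\Omega$. In (5), $(\sigma,\tau)\in\operatorname{Sym}(a)\times\operatorname{Sym}(b)$ acts by $(i,j)^{(\sigma,\tau)}=(i^\sigma,j^\tau)$. In (4), $\operatorname{Sym}(a)\wr C_2$ is generated by $\operatorname{Sym}(a)\times\operatorname{Sym}(a)$ acting by $(i,j)^{(\sigma,\tau)}=(i^\sigma,j^\tau)$ together with the transposition $(i,j)\mapsto(j,i)$. In (3), $C_2\wr\operatorname{Sym}(b)=\operatorname{Sym}(b)\ltimes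 C_2^b$, with $\sigma\in\operatorname{Sym}(b)$ acting by $(i,j)^\sigma=(i,j^\sigma)$ and $\boldsymbol{\tau}=(\tau_1,\ldots,\tau_b)\in C_2^b$ acting by $(i,j)^{\boldsymbol{\tau}}=(i^{\tau_j},j)$, where $C_2=\operatorname{Sym}(\{1,2\})$. *)

theory Defs
  imports
    Complex_Main
    "HOL-Algebra.Sym_Groups"
    "HOL-Algebra.Generated_Groups"
    "HOL-Combinatorics.Orbits"
    "HOL-Library.Function_Algebras"
    "HOL-Library.FuncSet"
    "HOL-Library.Z2"
begin

text \<open>
  An \<open>a \<times> b\<close> matrix over the field of two elements is a function \<open>nat \<times> nat \<Rightarrow> bit\<close> vanishing
  outside \<open>\<Omega> a b\<close>, with 1-based indices. The ambient space of all functions carries the pointwise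
  vector space structure; everything below lives in the span of the elementary matrices
  indexed by \<open>\<Omega> a b\<close>.
\<close>

type_synonym f2_mat = "nat \<times> nat \<Rightarrow> bit"

definition mat_scale :: "bit \<Rightarrow> f2_mat \<Rightarrow> f2_mat"
  where "mat_scale k v = (\<lambda>x. k * v x)"

interpretation mat_vs: vector_space mat_scale
  by unfold_locales (auto simp: mat_scale_def fun_eq_iff algebra_simps)

definition \<Omega> :: "nat \<Rightarrow> nat \<Rightarrow> (nat \<times> nat) set"
  where "\<Omega> a b = {1..a} \<times> {1..b}"

definition elem_mat :: "nat \<times> nat \<Rightarrow> f2_mat"
  where "elem_mat x = (\<lambda>y. if y = x then 1 else 0)"

definition row_vec :: "nat \<Rightarrow> nat \<Rightarrow> f2_mat"
  where "row_vec b i = (\<Sum>j = 1..b. elem_mat (i, j))"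

definition col_vec :: "nat \<Rightarrow> nat \<Rightarrow> f2_mat"
  where "col_vec a j = (\<Sum>i = 1..a. elem_mat (i, j))"

definition C0 :: "nat \<Rightarrow> nat \<Rightarrow> f2_mat set"
  where "C0 a b = mat_vs.span (row_vec b ` {1..a} \<union> col_vec a ` {1..b})"

text \<open>
  The multiplication is \<open>(\<circ>)\<close>, as in \<^const>\<open>sym_group\<close>. For groups acting on the right this is the
  opposite multiplication, which has the same subgroups.
\<close>

definition Sym :: "'a set \<Rightarrow> ('a \<Rightarrow> 'a) monoid"
  where "Sym S = \<lparr>carrier = {p. p permutes S}, mult = (\<circ>), one = id\<rparr>"

text \<open>
  The linear map induced by the permutation \<open>elem_mat x \<mapsto> elem_mat (\<pi> x)\<close> of the standard basis.
\<close>

definition induced_map :: "nat \<Rightarrow> nat \<Rightarrow> (nat \<times> nat \<Rightarrow> nat \<times> nat) \<Rightarrow> f2_mat \<Rightarrow> f2_mat"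
  where "induced_map a b \<pi> v = (\<Sum>x\<in>\<Omega> a b. mat_scale (v x) (elem_mat (\<pi> x)))"

definition Aut :: "nat \<Rightarrow> nat \<Rightarrow> f2_mat set \<Rightarrow> (nat \<times> nat \<Rightarrow> nat \<times> nat) set"
  where "Aut a b C = {\<pi> \<in> carrier (Sym (\<Omega> a b)). induced_map a b \<pi> ` C \<subseteq> C}"

text \<open>
  The groups of permutations of \<open>\<Omega> a b\<close>. Permutations fix every point outside their domain, so
  actions given by formulas on \<open>\<Omega> a b\<close> are extended by the identity using \<^const>\<open>perm_restrict\<close>.
\<close>

definition prod_act ::
    "nat \<Rightarrow> nat \<Rightarrow> (nat \<Rightarrow> nat) \<times> (nat \<Rightarrow> nat) \<Rightarrow> nat \<times> nat \<Rightarrow> nat \<times> nat"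
  where "prod_act a b = (\<lambda>(\<sigma>, \<tau>). perm_restrict (\<lambda>(i, j). (\<sigma> i, \<tau> j)) (\<Omega> a b))"

definition Sym_times_Sym :: "nat \<Rightarrow> nat \<Rightarrow> (nat \<times> nat \<Rightarrow> nat \<times> nat) set"
  where "Sym_times_Sym a b = prod_act a b ` carrier (sym_group a \<times>\<times> sym_group b)"

definition Sym_wr_C2 :: "nat \<Rightarrow> (nat \<times> nat \<Rightarrow> nat \<times> nat) set"
  where "Sym_wr_C2 a =
    generate (Sym (\<Omega> a a))
      (Sym_times_Sym a a \<union> {perm_restrict (\<lambda>(i, j). (j, i)) (\<Omega> a a)})"

definition top_act :: "nat \<Rightarrow> (nat \<Rightarrow> nat) \<Rightarrow> nat \<times> nat \<Rightarrow> nat \<times> nat"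
  where "top_act b \<sigma> = perm_restrict (\<lambda>(i, j). (i, \<sigma> j)) (\<Omega> 2 b)"

definition base_act :: "nat \<Rightarrow> (nat \<Rightarrow> nat \<Rightarrow> nat) \<Rightarrow> nat \<times> nat \<Rightarrow> nat \<times> nat"
  where "base_act b \<tau> = perm_restrict (\<lambda>(i, j). (\<tau> j i, j)) (\<Omega> 2 b)"

text \<open>
  The semidirect product of \<open>Sym b\<close> with the base group: every element is a product of some \<open>\<sigma>\<close>
  with some \<open>\<tau>\<close>, which under the right action means applying \<open>\<sigma>\<close> first.
\<close>

definition C2_wr_Sym :: "nat \<Rightarrow> (nat \<times> nat \<Rightarrow> nat \<times> nat) set"
  where "C2_wr_Sym b =
    {base_act b \<tau> \<circ> top_act b \<sigma> | \<sigma> \<tau>.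
       \<sigma> \<in> carrier (sym_group b) \<and> \<tau> \<in> {1..b} \<rightarrow>\<^sub>E carrier (sym_group 2)}"

text \<open>
  The sets above are subgroups of \<open>Sym (\<Omega> a b)\<close>, and the parametrising actions are faithful, so the
  abstract groups may be identified with their images.
\<close>

lemma group_Sym: "group (Sym S)"
proof (rule groupI)
  fix x assume "x \<in> carrier (Sym S)"
  then show "\<exists>y\<in>carrier (Sym S). y \<otimes>\<^bsub>Sym S\<^esub> x = \<one>\<^bsub>Sym S\<^esub>"
    by (auto simp: Sym_def intro!: exI[of _ "inv_into UNIV x"] permutes_inv permutes_inv_o(2))
qed (auto simp: Sym_def permutes_compose permutes_id comp_assoc)

lemma prod_act_permutes:
  assumes "\<sigma> permutes {1..a}" "\<tau> permutes {1..b}"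
  shows "prod_act a b (\<sigma>, \<tau>) permutes \<Omega> a b"
proof (rule bij_imp_permutes)
  have "bij_betw (map_prod \<sigma> \<tau>) (\<Omega> a b) (\<Omega> a b)"
    unfolding \<Omega>_def using assms by (intro bij_betw_map_prod permutes_imp_bij)
  then show "bij_betw (prod_act a b (\<sigma>, \<tau>)) (\<Omega> a b) (\<Omega> a b)"
    by (rule bij_betw_cong[THEN iffD1, rotated]) (auto simp: prod_act_def perm_restrict_def)
qed (simp add: prod_act_def perm_restrict_def)

lemma prod_act_hom: "prod_act a b \<in> hom (sym_group a \<times>\<times> sym_group b) (Sym (\<Omega> a b))"
proof (rule homI)
  fix x y assume "x \<in> carrier (sym_group a \<times>\<times> sym_group b)"
    "y \<in> carrier (sym_group a \<times>\<times> sym_group b)"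
  then show "prod_act a b (x \<otimes>\<^bsub>sym_group a \<times>\<times> sym_group b\<^esub> y) =
      prod_act a b x \<otimes>\<^bsub>Sym (\<Omega> a b)\<^esub> prod_act a b y"
    by (cases x; cases y)
      (auto simp: fun_eq_iff Sym_def sym_group_def prod_act_def perm_restrict_def \<Omega>_def
        permutes_in_image simp del: atLeastAtMost_iff)
qed (auto simp: Sym_def sym_group_carrier prod_act_permutes)

lemma prod_act_inj:
  assumes "1 \<le> a" "1 \<le> b"
  shows "inj_on (prod_act a b) (carrier (sym_group a \<times>\<times> sym_group b))"
proof (rule inj_onI, clarsimp simp: sym_group_carrier)
  fix \<sigma> \<tau> \<sigma>' \<tau>'
  assume p: "\<sigma> permutes {Suc 0..a}" "\<tau> permutes {Suc 0..b}"
    "\<sigma>' permutes {Suc 0..a}" "\<tau>' permutes {Suc 0..b}"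
    and eq: "prod_act a b (\<sigma>, \<tau>) = prod_act a b (\<sigma>', \<tau>')"
  have *: "\<sigma> i = \<sigma>' i \<and> \<tau> j = \<tau>' j" if "i \<in> {1..a}" "j \<in> {1..b}" for i j :: nat
    using fun_cong[OF eq, of "(i, j)"] that by (auto simp: prod_act_def perm_restrict_def \<Omega>_def)
  have "\<sigma> i = \<sigma>' i" for i
    using *[of i 1] assms(2) p(1,3) by (cases "i \<in> {1..a}") (auto simp: permutes_def)
  moreover have "\<tau> j = \<tau>' j" for j
    using *[of 1 j] assms(1) p(2,4) by (cases "j \<in> {1..b}") (auto simp: permutes_def)
  ultimately show "\<sigma> = \<sigma>' \<and> \<tau> = \<tau>'" by auto
qed

lemma subgroup_Sym_times_Sym: "subgroup (Sym_times_Sym a b) (Sym (\<Omega> a b))"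
  unfolding Sym_times_Sym_def
  by (rule group_hom.img_is_subgroup)
    (auto intro!: group_hom.intro group_hom_axioms.intro prod_act_hom group_Sym
      DirProd_group sym_group_is_group)

lemma subgroup_Sym_wr_C2: "subgroup (Sym_wr_C2 a) (Sym (\<Omega> a a))"
  unfolding Sym_wr_C2_def
proof (rule group.generate_is_subgroup[OF group_Sym])
  have "perm_restrict (\<lambda>(i, j). (j, i)) (\<Omega> a a) permutes \<Omega> a a"
    by (rule bij_imp_permutes)
      (auto simp: perm_restrict_def \<Omega>_def intro!: bij_betwI[where g = "\<lambda>(i, j). (j, i)"])
  then show "Sym_times_Sym a a \<union> {perm_restrict (\<lambda>(i, j). (j, i)) (\<Omega> a a)}
      \<subseteq> carrier (Sym (\<Omega> a a))"
    using subgroup.subset[OF subgroup_Sym_times_Sym] by (auto simp: Sym_def)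
qed

lemma base_top_act:
  assumes "\<sigma> permutes {1..b}"
  shows "(base_act b \<tau> \<circ> top_act b \<sigma>) (i, j) =
    (if (i, j) \<in> \<Omega> 2 b then (\<tau> (\<sigma> j) i, \<sigma> j) else (i, j))"
  using permutes_in_image[OF assms, of j]
  by (auto simp: base_act_def top_act_def perm_restrict_def \<Omega>_def)

lemma base_act_top_act_inj:
  "inj_on (\<lambda>(\<sigma>, \<tau>). base_act b \<tau> \<circ> top_act b \<sigma>)
    (carrier (sym_group b) \<times> ({1..b} \<rightarrow>\<^sub>E carrier (sym_group 2)))"
proof (rule inj_onI, clarify)
  fix \<sigma> \<tau> \<sigma>' \<tau>'
  assume s: "\<sigma> \<in> carrier (sym_group b)" "\<sigma>' \<in> carrier (sym_group b)"
    and t: "\<tau> \<in> {1..b} \<rightarrow>\<^sub>E carrier (sym_group 2)" "\<tau>' \<in> {1..b} \<rightarrow>\<^sub>E carrier (sym_group 2)"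
    and eq: "base_act b \<tau> \<circ> top_act b \<sigma> = base_act b \<tau>' \<circ> top_act b \<sigma>'"
  have s': "\<sigma> permutes {1..b}" "\<sigma>' permutes {1..b}"
    using s by (auto simp: sym_group_carrier)
  have *: "\<tau> (\<sigma> j) i = \<tau>' (\<sigma>' j) i \<and> \<sigma> j = \<sigma>' j" if "i \<in> {1..2}" "j \<in> {1..b}" for i j :: nat
    using fun_cong[OF eq, of "(i, j)"] that unfolding base_top_act[OF s'(1)] base_top_act[OF s'(2)]
    by (auto simp: \<Omega>_def)
  have \<sigma>: "\<sigma> = \<sigma>'"
  proof
    fix j show "\<sigma> j = \<sigma>' j"
      using *[of 1 j] s' by (cases "j \<in> {1..b}") (auto simp: permutes_def)
  qed
  have "\<tau> = \<tau>'"
  proof (rule PiE_ext[OF t])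
    fix j assume j: "j \<in> {1..b}"
    define k where "k = inv_into UNIV \<sigma> j"
    have k: "k \<in> {1..b}" "\<sigma> k = j"
      unfolding k_def using s'(1) j by (auto simp only: permutes_inverses permutes_in_image[OF permutes_inv])
    have p: "\<tau> j permutes {1..2}" "\<tau>' j permutes {1..2}"
      using t j by (auto simp: sym_group_carrier simp del: atLeastAtMost_iff dest!: PiE_mem)
    show "\<tau> j = \<tau>' j"
    proof
      fix i show "\<tau> j i = \<tau>' j i"
      proof (cases "i \<in> {1..2}")
        case True
        then show ?thesis using *[of i k] k \<sigma> by auto
      next
        case False
        then show ?thesis using p by (auto simp: permutes_def)
      qed
    qed
  qed
  with \<sigma> show "\<sigma> = \<sigma>' \<and> \<tau> = \<tau>'" by simp
qed

lemma C2_wr_Sym_iff: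
  "\<pi> \<in> C2_wr_Sym b \<longleftrightarrow>
    (\<exists>\<sigma> \<tau>. \<sigma> permutes {1..b} \<and> (\<forall>j\<in>{1..b}. \<tau> j permutes {1..2}) \<and>
      (\<forall>i j. \<pi> (i, j) = (if (i, j) \<in> \<Omega> 2 b then (\<tau> (\<sigma> j) i, \<sigma> j) else (i, j))))"
  (is "?L \<longleftrightarrow> ?R")
proof
  assume ?L
  then obtain \<sigma> \<tau> where st: "\<sigma> permutes {1..b}" "\<tau> \<in> {1..b} \<rightarrow>\<^sub>E carrier (sym_group 2)"
    and \<pi>: "\<pi> = base_act b \<tau> \<circ> top_act b \<sigma>"
    unfolding C2_wr_Sym_def sym_group_carrier by blast
  have "\<forall>j\<in>{1..b}. \<tau> j permutes {1..2}"
    using PiE_mem[OF st(2)] by (simp only: sym_group_carrier) blast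
  moreover have "\<pi> (i, j) = (if (i, j) \<in> \<Omega> 2 b then (\<tau> (\<sigma> j) i, \<sigma> j) else (i, j))" for i j :: nat
    unfolding \<pi> by (rule base_top_act[OF st(1)])
  ultimately show ?R using st(1) by blast
next
  assume ?R
  then obtain \<sigma> \<tau> where st: "\<sigma> permutes {1..b}" "\<And>j. j \<in> {1..b} \<Longrightarrow> \<tau> j permutes {1..2}"
    and \<pi>: "\<And>i j. \<pi> (i, j) = (if (i, j) \<in> \<Omega> 2 b then (\<tau> (\<sigma> j) i, \<sigma> j) else (i, j))"
    by blast
  define \<tau>' where "\<tau>' = restrict \<tau> {1..b}"
  have "\<tau>' \<in> {1..b} \<rightarrow>\<^sub>E carrier (sym_group 2)"
    unfolding \<tau>'_def using st(2)
    by (intro restrict_PiE_iff[THEN iffD2] ballI) (simp only: sym_group_carrier)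
  moreover have "\<pi> = base_act b \<tau>' \<circ> top_act b \<sigma>"
  proof
    fix x :: "nat \<times> nat"
    obtain i j where x: "x = (i, j)" by (cases x)
    have "\<sigma> j \<in> {1..b} \<longleftrightarrow> j \<in> {1..b}" by (rule permutes_in_image[OF st(1)])
    then show "\<pi> x = (base_act b \<tau>' \<circ> top_act b \<sigma>) x"
      unfolding x \<pi> base_top_act[OF st(1)] by (auto simp: \<tau>'_def \<Omega>_def)
  qed
  ultimately show ?L unfolding C2_wr_Sym_def using st(1) sym_group_carrier by blast
qed

lemma subgroup_C2_wr_Sym: "subgroup (C2_wr_Sym b) (Sym (\<Omega> 2 b))"
proof -
  have one: "id \<in> C2_wr_Sym b"
    unfolding C2_wr_Sym_iff
    by (intro exI[of _ id] exI[of _ "\<lambda>_. id"]) (simp add: permutes_id)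
  have mult: "\<pi> \<circ> \<pi>' \<in> C2_wr_Sym b" if A: "\<pi> \<in> C2_wr_Sym b" "\<pi>' \<in> C2_wr_Sym b" for \<pi> \<pi>'
  proof -
    obtain \<sigma> \<tau> where 1: "\<sigma> permutes {1..b}" "\<And>j. j \<in> {1..b} \<Longrightarrow> \<tau> j permutes {1..2}"
      "\<And>i j. \<pi> (i, j) = (if (i, j) \<in> \<Omega> 2 b then (\<tau> (\<sigma> j) i, \<sigma> j) else (i, j))"
      using A(1) unfolding C2_wr_Sym_iff by blast
    obtain \<sigma>' \<tau>' where 2: "\<sigma>' permutes {1..b}" "\<And>j. j \<in> {1..b} \<Longrightarrow> \<tau>' j permutes {1..2}"
      "\<And>i j. \<pi>' (i, j) = (if (i, j) \<in> \<Omega> 2 b then (\<tau>' (\<sigma>' j) i, \<sigma>' j) else (i, j))"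
      using A(2) unfolding C2_wr_Sym_iff by blast
    have "\<tau> j \<circ> \<tau>' (inv_into UNIV \<sigma> j) permutes {1..2}" if "j \<in> {1..b}" for j
      using that 1(2) 2(2) permutes_in_image[OF permutes_inv[OF 1(1)]]
      by (intro permutes_compose) blast+
    moreover have "(\<pi> \<circ> \<pi>') (i, j) =
        (if (i, j) \<in> \<Omega> 2 b
         then ((\<tau> ((\<sigma> \<circ> \<sigma>') j) \<circ> \<tau>' (inv_into UNIV \<sigma> ((\<sigma> \<circ> \<sigma>') j))) i, (\<sigma> \<circ> \<sigma>') j)
         else (i, j))" for i j :: nat
    proof (cases "(i, j) \<in> \<Omega> 2 b")
      case True
      then have j: "i \<in> {1..2}" "j \<in> {1..b}" by (auto simp: \<Omega>_def)
      have sj: "\<sigma>' j \<in> {1..b}" using permutes_in_image[OF 2(1)] j(2) by blast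
      have "\<tau>' (\<sigma>' j) i \<in> {1..2}" using permutes_in_image[OF 2(2)[OF sj]] j(1) by blast
      then have "(\<tau>' (\<sigma>' j) i, \<sigma>' j) \<in> \<Omega> 2 b" using sj by (auto simp: \<Omega>_def)
      then show ?thesis using True by (simp add: 1(3) 2(3) permutes_inverses(2)[OF 1(1)])
    qed (simp add: 1(3) 2(3))
    ultimately show ?thesis
      unfolding C2_wr_Sym_iff using permutes_compose[OF 2(1) 1(1)]
      by (intro exI[of _ "\<sigma> \<circ> \<sigma>'"] exI[of _ "\<lambda>j. \<tau> j \<circ> \<tau>' (inv_into UNIV \<sigma> j)"]) blast
  qed
  have inv: "\<exists>\<pi>'\<in>C2_wr_Sym b. \<pi>' \<circ> \<pi> = id \<and> \<pi> \<circ> \<pi>' = id" if A: "\<pi> \<in> C2_wr_Sym b" for \<pi>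
  proof -
    obtain \<sigma> \<tau> where 1: "\<sigma> permutes {1..b}" "\<And>j. j \<in> {1..b} \<Longrightarrow> \<tau> j permutes {1..2}"
      "\<And>i j. \<pi> (i, j) = (if (i, j) \<in> \<Omega> 2 b then (\<tau> (\<sigma> j) i, \<sigma> j) else (i, j))"
      using A unfolding C2_wr_Sym_iff by blast
    define \<pi>' where "\<pi>' = (\<lambda>(i, j). if (i, j) \<in> \<Omega> 2 b
      then (inv_into UNIV (\<tau> (\<sigma> (inv_into UNIV \<sigma> j))) i, inv_into UNIV \<sigma> j) else (i, j))"
    have "\<pi>' \<in> C2_wr_Sym b"
      unfolding C2_wr_Sym_iff
      using permutes_inv[OF 1(1)] permutes_inv[OF 1(2)] permutes_in_image[OF 1(1)]
      by (intro exI[of _ "inv_into UNIV \<sigma>"] exI[of _ "\<lambda>j. inv_into UNIV (\<tau> (\<sigma> j))"])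
        (simp add: \<pi>'_def)
    moreover have "(\<pi>' \<circ> \<pi>) (i, j) = (i, j) \<and> (\<pi> \<circ> \<pi>') (i, j) = (i, j)" for i j :: nat
    proof (cases "(i, j) \<in> \<Omega> 2 b")
      case True
      then have j: "i \<in> {1..2}" "j \<in> {1..b}" by (auto simp: \<Omega>_def)
      have sj: "\<sigma> j \<in> {1..b}" "inv_into UNIV \<sigma> j \<in> {1..b}"
        using permutes_in_image[OF 1(1)] permutes_in_image[OF permutes_inv[OF 1(1)]] j(2) by blast+
      have "\<tau> (\<sigma> j) i \<in> {1..2}" "inv_into UNIV (\<tau> j) i \<in> {1..2}"
        using permutes_in_image[OF 1(2)[OF sj(1)]] permutes_in_image[OF permutes_inv[OF 1(2)[OF j(2)]]]
          j(1) by blast+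
      then have "(\<tau> (\<sigma> j) i, \<sigma> j) \<in> \<Omega> 2 b" "(inv_into UNIV (\<tau> j) i, inv_into UNIV \<sigma> j) \<in> \<Omega> 2 b"
        using sj by (auto simp: \<Omega>_def)
      then show ?thesis
        using True by (simp add: \<pi>'_def 1(3) permutes_inverses[OF 1(1)]
          permutes_inverses[OF 1(2)[OF sj(1)]] permutes_inverses[OF 1(2)[OF j(2)]])
    qed (simp add: \<pi>'_def 1(3))
    ultimately show ?thesis by (intro bexI[of _ \<pi>']) (auto simp: fun_eq_iff)
  qed
  have carr: "C2_wr_Sym b \<subseteq> carrier (Sym (\<Omega> 2 b))"
  proof
    fix \<pi> assume A: "\<pi> \<in> C2_wr_Sym b"
    from inv[OF A] have "bij \<pi>" by (metis o_bij)
    moreover have "\<pi> x = x" if "x \<notin> \<Omega> 2 b" for x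
      using A that unfolding C2_wr_Sym_iff by (cases x) auto
    ultimately show "\<pi> \<in> carrier (Sym (\<Omega> 2 b))"
      by (auto simp: Sym_def permutes_def bij_iff)
  qed
  interpret group "Sym (\<Omega> 2 b)" by (rule group_Sym)
  show ?thesis
  proof (rule subgroupI[OF carr])
    fix \<pi> assume A: "\<pi> \<in> C2_wr_Sym b"
    then obtain \<pi>' where p: "\<pi>' \<in> C2_wr_Sym b" "\<pi>' \<circ> \<pi> = id" using inv by blast
    have "inv\<^bsub>Sym (\<Omega> 2 b)\<^esub> \<pi> = \<pi>'"
      by (rule inv_equality) (use A p carr in \<open>auto simp: Sym_def\<close>)
    then show "inv\<^bsub>Sym (\<Omega> 2 b)\<^esub> \<pi> \<in> C2_wr_Sym b" using p by simp
  qed (use one mult in \<open>auto simp: Sym_def\<close>)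
qed

end

theory Submission
  imports Defs "HOL-Library.Indicator_Function"
begin

text \<open>
  Read \<open>\<Omega> a b\<close> as the edge set of the complete bipartite graph whose vertices are the \<open>a\<close> row
  indices and the \<open>b\<close> column indices. A row \<open>row_vec b i\<close> or column \<open>col_vec a j\<close> is then the star
  of a vertex, so \<open>C0 a b\<close> is the cut space of this graph: its elements are the indicators of the
  sets \<open>{(i, j). (i \<in> S) \<noteq> (j \<in> T)}\<close>. Hence \<open>Aut a b (C0 a b)\<close> consists of the permutations of the
  edges that map cuts to cuts (\<open>Aut_C0_iff\<close>), and linear algebra is no longer needed.

  The inclusions from right to left say that certain permutations map cuts to cuts. For \<open>a = 1\<close>
  every set of edges is a cut. For \<open>a = 2\<close> a set is a cut if and only if either all columns or
  none of them meet it in an odd number of points (\<open>bip_cuts_2_iff\<close>); this is visibly invariant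
  under permuting the columns and acting inside each of them, and for \<open>b = 2\<close> it just says that
  the set has even size. The group \<open>Sym_times_Sym a b\<close> and the transposition act on the vertices
  of the graph.

  For the other inclusions suppose \<open>2 \<le> a \<le> b\<close> and \<open>2 < b\<close>. With \<open>s = card S\<close> and \<open>t = card T\<close>,
  where \<open>2 * t \<le> b\<close> after complementing both sets, the cut has \<open>s * (b - 2 * t) + a * t\<close> elements.
  This equals \<open>a\<close> only for a single column, or for a single row when \<open>a = b\<close> (\<open>bip_cut_card_a\<close>).
  So an automorphism maps columns to columns, or, when \<open>a = b\<close>, all columns to rows
  (\<open>column_images\<close>); in the second case composing with the transposition returns to the first.
  A permutation preserving the partition into columns lies in \<open>C2 \<wr> Sym b\<close> when \<open>a = 2\<close>. When
  \<open>a > 2\<close>, the image of a row is a cut meeting each column exactly once; two columns of a cut are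
  equal or complementary, and complements of single points in a column are not single points, so
  the image is a row again (\<open>rows_to_rows\<close>) and the permutation lies in \<open>Sym_times_Sym a b\<close>.
\<close>

section \<open>The code as a cut space\<close>

definition bip_cut :: "nat \<Rightarrow> nat \<Rightarrow> nat set \<Rightarrow> nat set \<Rightarrow> (nat \<times> nat) set"
  where "bip_cut a b S T = {(i, j). (i, j) \<in> \<Omega> a b \<and> (i \<in> S) \<noteq> (j \<in> T)}"

definition bip_cuts :: "nat \<Rightarrow> nat \<Rightarrow> (nat \<times> nat) set set"
  where "bip_cuts a b = {bip_cut a b S T | S T. True}"

lemma mem_\<Omega> [simp]: "(i, j) \<in> \<Omega> a b \<longleftrightarrow> i \<in> {1..a} \<and> j \<in> {1..b}"
  by (simp add: \<Omega>_def)

lemma finite_\<Omega> [simp]: "finite (\<Omega> a b)"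
  by (simp add: \<Omega>_def)

lemma mem_bip_cut:
  "(i, j) \<in> bip_cut a b S T \<longleftrightarrow> (i \<in> {1..a} \<and> j \<in> {1..b}) \<and> (i \<in> S) \<noteq> (j \<in> T)"
  by (simp add: bip_cut_def)

lemma bip_cut_in_bip_cuts: "bip_cut a b S T \<in> bip_cuts a b"
  by (auto simp: bip_cuts_def)

lemma bip_cuts_subset: "A \<in> bip_cuts a b \<Longrightarrow> A \<subseteq> \<Omega> a b"
  by (auto simp: bip_cuts_def bip_cut_def)

lemma finite_bip_cuts: "finite (bip_cuts a b)"
  by (rule finite_subset[of _ "Pow (\<Omega> a b)"]) (auto dest: bip_cuts_subset)

lemma row_in_bip_cuts: "i \<in> {1..a} \<Longrightarrow> {i} \<times> {1..b} \<in> bip_cuts a b"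
  and column_in_bip_cuts: "j \<in> {1..b} \<Longrightarrow> {1..a} \<times> {j} \<in> bip_cuts a b"
proof -
  assume "i \<in> {1..a}"
  then have "{i} \<times> {1..b} = bip_cut a b {i} {}" by (auto simp: bip_cut_def)
  then show "{i} \<times> {1..b} \<in> bip_cuts a b" by (simp add: bip_cut_in_bip_cuts)
next
  assume "j \<in> {1..b}"
  then have "{1..a} \<times> {j} = bip_cut a b {} {j}" by (auto simp: bip_cut_def)
  then show "{1..a} \<times> {j} \<in> bip_cuts a b" by (simp add: bip_cut_in_bip_cuts)
qed

lemma indicator_eq_sum_elem_mat:
  assumes "finite A"
  shows "indicator A = (\<Sum>x\<in>A. elem_mat x)"
  using assms
proof (induction A rule: finite_induct)
  case (insert x A)
  have "indicator (insert x A) = elem_mat x + indicator A"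
    using insert.hyps by (auto simp: fun_eq_iff elem_mat_def indicator_def)
  then show ?case using insert by simp
qed (simp add: fun_eq_iff)

lemma induced_map_indicator:
  assumes "\<pi> permutes \<Omega> a b" "A \<subseteq> \<Omega> a b"
  shows "induced_map a b \<pi> (indicator A) = indicator (\<pi> ` A)"
proof -
  have fin: "finite A" using assms(2) finite_\<Omega> finite_subset by blast
  have "induced_map a b \<pi> (indicator A) = (\<Sum>x\<in>\<Omega> a b. if x \<in> A then elem_mat (\<pi> x) else 0)"
    unfolding induced_map_def
    by (intro sum.cong) (auto simp: mat_scale_def fun_eq_iff)
  also have "\<dots> = (\<Sum>x\<in>A. elem_mat (\<pi> x))"
    using assms(2) by (simp add: sum.If_cases Int_absorb1)
  also have "\<dots> = (\<Sum>x\<in>\<pi> ` A. elem_mat x)"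
    using permutes_inj_on[OF assms(1)] by (simp add: sum.reindex)
  finally show ?thesis using fin by (simp add: indicator_eq_sum_elem_mat)
qed

lemma row_vec_eq: "row_vec b i = indicator ({i} \<times> {1..b})"
  unfolding row_vec_def
  by (simp add: indicator_eq_sum_elem_mat sum.cartesian_product')

lemma col_vec_eq: "col_vec a j = indicator ({1..a} \<times> {j})"
  unfolding col_vec_def
  by (simp add: indicator_eq_sum_elem_mat sum.cartesian_product')

text \<open>
  Addition over the field of two elements is symmetric difference, and cuts are closed under it
  because the symmetric difference can be taken on the row side and on the column side separately.
\<close>

lemma C0_eq_cuts: "C0 a b = indicator ` bip_cuts a b"
proof
  have "mat_vs.subspace (indicator ` bip_cuts a b)"
  proof (rule mat_vs.subspaceI)
    have "0 = (indicator (bip_cut a b {} {}) :: f2_mat)"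
      by (auto simp: fun_eq_iff indicator_def bip_cut_def)
    then show "(0 :: f2_mat) \<in> indicator ` bip_cuts a b"
      by (rule image_eqI) (rule bip_cut_in_bip_cuts)
    then show "mat_scale c x \<in> indicator ` bip_cuts a b" if "x \<in> indicator ` bip_cuts a b" for c x
      using that by (cases c) simp_all
    fix x y :: f2_mat assume "x \<in> indicator ` bip_cuts a b" "y \<in> indicator ` bip_cuts a b"
    then obtain S T S' T' where
      "x = indicator (bip_cut a b S T)" "y = indicator (bip_cut a b S' T')"
      by (auto simp: bip_cuts_def)
    then have "x + y = indicator (bip_cut a b (sym_diff S S') (sym_diff T T'))"
      by (auto simp: fun_eq_iff indicator_def bip_cut_def)
    then show "x + y \<in> indicator ` bip_cuts a b"
      by (rule image_eqI) (rule bip_cut_in_bip_cuts)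
  qed
  moreover have "row_vec b ` {1..a} \<union> col_vec a ` {1..b} \<subseteq> indicator ` bip_cuts a b"
    using row_in_bip_cuts column_in_bip_cuts by (auto simp: row_vec_eq col_vec_eq)
  ultimately show "C0 a b \<subseteq> indicator ` bip_cuts a b"
    unfolding C0_def by (intro mat_vs.span_minimal)
next
  show "indicator ` bip_cuts a b \<subseteq> C0 a b"
  proof
    fix v :: f2_mat assume "v \<in> indicator ` bip_cuts a b"
    then obtain S T where v: "v = indicator (bip_cut a b S T)"
      by (auto simp: bip_cuts_def)
    have "v = indicator ((S \<inter> {1..a}) \<times> {1..b}) + indicator ({1..a} \<times> (T \<inter> {1..b}))"
      unfolding v by (auto simp: fun_eq_iff indicator_def bip_cut_def)
    also have "indicator ((S \<inter> {1..a}) \<times> {1..b}) = (\<Sum>i\<in>S \<inter> {1..a}. row_vec b i)"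
      unfolding row_vec_def by (simp add: indicator_eq_sum_elem_mat sum.cartesian_product')
    also have "indicator ({1..a} \<times> (T \<inter> {1..b})) = (\<Sum>j\<in>T \<inter> {1..b}. col_vec a j)"
      unfolding col_vec_def
      by (subst sum.swap) (simp add: indicator_eq_sum_elem_mat sum.cartesian_product')
    finally show "v \<in> C0 a b"
      unfolding C0_def
      by (simp only:) (intro mat_vs.span_add mat_vs.span_sum mat_vs.span_base; blast)
  qed
qed

lemma Aut_C0_iff:
  "\<pi> \<in> Aut a b (C0 a b) \<longleftrightarrow>
    \<pi> permutes \<Omega> a b \<and> (\<forall>A\<in>bip_cuts a b. \<pi> ` A \<in> bip_cuts a b)"
proof -
  have inj: "inj (indicator :: (nat \<times> nat) set \<Rightarrow> f2_mat)"
    by (auto simp: inj_on_def fun_eq_iff indicator_def split: if_splits)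
  have "induced_map a b \<pi> ` C0 a b \<subseteq> C0 a b \<longleftrightarrow> (\<forall>A\<in>bip_cuts a b. \<pi> ` A \<in> bip_cuts a b)"
    if "\<pi> permutes \<Omega> a b"
    using that bip_cuts_subset
    by (auto simp: C0_eq_cuts image_subset_iff induced_map_indicator inj_image_mem_iff[OF inj])
  then show ?thesis by (auto simp: Aut_def Sym_def)
qed

text \<open>
  Closure under inverses rests on finiteness: an injective self-map of the finite set of cuts is
  onto.
\<close>

lemma subgroup_Aut_C0: "subgroup (Aut a b (C0 a b)) (Sym (\<Omega> a b))"
proof -
  interpret group "Sym (\<Omega> a b)" by (rule group_Sym)
  show ?thesis
  proof (rule subgroupI)
    have "id \<in> Aut a b (C0 a b)" by (simp add: Aut_C0_iff permutes_id)
    then show "Aut a b (C0 a b) \<noteq> {}" by blast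
    fix \<pi> assume A: "\<pi> \<in> Aut a b (C0 a b)"
    then have p: "\<pi> permutes \<Omega> a b" by (simp add: Aut_C0_iff)
    have "inj_on ((`) \<pi>) (bip_cuts a b)"
      using permutes_inj[OF p] by (simp add: inj_on_def inj_image_eq_iff)
    moreover have "(`) \<pi> ` bip_cuts a b \<subseteq> bip_cuts a b"
      using A by (auto simp: Aut_C0_iff)
    ultimately have "(`) \<pi> ` bip_cuts a b = bip_cuts a b"
      by (simp add: endo_inj_surj finite_bip_cuts)
    then have "inv_into UNIV \<pi> ` A \<in> bip_cuts a b" if "A \<in> bip_cuts a b" for A
      using that permutes_inj[OF p] by (metis (no_types, lifting) image_iff image_inv_f_f)
    then have "inv_into UNIV \<pi> \<in> Aut a b (C0 a b)"
      by (simp add: Aut_C0_iff permutes_inv[OF p])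
    moreover have "inv\<^bsub>Sym (\<Omega> a b)\<^esub> \<pi> = inv_into UNIV \<pi>"
      by (rule inv_equality) (simp_all add: Sym_def p permutes_inv permutes_inv_o[OF p])
    ultimately show "inv\<^bsub>Sym (\<Omega> a b)\<^esub> \<pi> \<in> Aut a b (C0 a b)" by simp
  next
    fix \<pi> \<rho> assume "\<pi> \<in> Aut a b (C0 a b)" "\<rho> \<in> Aut a b (C0 a b)"
    then show "\<pi> \<otimes>\<^bsub>Sym (\<Omega> a b)\<^esub> \<rho> \<in> Aut a b (C0 a b)"
      by (auto simp: Aut_C0_iff Sym_def permutes_compose simp flip: image_image)
  qed (auto simp: Aut_C0_iff Sym_def)
qed

section \<open>Permutations that map cuts to cuts\<close>

lemma bip_cuts_1: "bip_cuts 1 b = Pow (\<Omega> 1 b)"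
proof
  show "Pow (\<Omega> 1 b) \<subseteq> bip_cuts 1 b"
  proof
    fix A assume "A \<in> Pow (\<Omega> 1 b)"
    then have "A = bip_cut 1 b {} {j. (1, j) \<in> A}"
      by (fastforce simp: bip_cut_def \<Omega>_def)
    then show "A \<in> bip_cuts 1 b" by (metis bip_cut_in_bip_cuts)
  qed
qed (use bip_cuts_subset in blast)

text \<open>
  The truth value \<open>p\<close> records whether the two rows lie on the same side of the cut.
\<close>

lemma bip_cuts_2_iff:
  assumes "A \<subseteq> \<Omega> 2 b"
  shows "A \<in> bip_cuts 2 b \<longleftrightarrow> (\<exists>p. \<forall>j\<in>{1..b}. ((1, j) \<in> A \<longleftrightarrow> (2, j) \<in> A) \<longleftrightarrow> p)"
proof
  assume "A \<in> bip_cuts 2 b"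
  then obtain S T where A: "A = bip_cut 2 b S T" by (auto simp: bip_cuts_def)
  show "\<exists>p. \<forall>j\<in>{1..b}. ((1, j) \<in> A \<longleftrightarrow> (2, j) \<in> A) \<longleftrightarrow> p"
    by (rule exI[of _ "(1 \<in> S) = (2 \<in> S)"]) (auto simp: A mem_bip_cut)
next
  assume "\<exists>p. \<forall>j\<in>{1..b}. ((1, j) \<in> A \<longleftrightarrow> (2, j) \<in> A) \<longleftrightarrow> p"
  then obtain p where p: "\<And>j. j \<in> {1..b} \<Longrightarrow> ((1, j) \<in> A \<longleftrightarrow> (2, j) \<in> A) \<longleftrightarrow> p" by blast
  have 12: "i = 1 \<or> i = 2" if "i \<in> {1..2}" for i :: nat using that by auto
  \<comment> \<open>Row 1 is put outside \<open>S\<close>, which forces \<open>T\<close> to be the trace of \<open>A\<close> on row 1.\<close>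
  have "A = bip_cut 2 b (if p then {} else {2}) {j. (1, j) \<in> A}"
  proof (rule Set.set_eqI)
    fix x :: "nat \<times> nat"
    obtain i j where x: "x = (i, j)" by (cases x)
    show "x \<in> A \<longleftrightarrow> x \<in> bip_cut 2 b (if p then {} else {2}) {j. (1, j) \<in> A}"
    proof (cases "(i, j) \<in> \<Omega> 2 b")
      case True
      then show ?thesis using 12[of i] p[of j] by (auto simp: x mem_bip_cut)
    next
      case False
      then show ?thesis using assms unfolding x bip_cut_def by blast
    qed
  qed
  then show "A \<in> bip_cuts 2 b" by (metis bip_cut_in_bip_cuts)
qed

lemma bip_cuts_2_2: "bip_cuts 2 2 = {A. A \<subseteq> \<Omega> 2 2 \<and> even (card A)}"
proof -
  have O: "\<Omega> 2 2 = {(1, 1), (1, 2), (2, 1), (2, 2)}" and I: "{1..2} = {1, 2 :: nat}"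
    by (auto simp: \<Omega>_def)
  have "A \<in> bip_cuts 2 2 \<longleftrightarrow> even (card A)" if "A \<subseteq> \<Omega> 2 2" for A
  proof -
    have "A \<in> bip_cuts 2 2 \<longleftrightarrow>
        (((1, 1) \<in> A \<longleftrightarrow> (2, 1) \<in> A) \<longleftrightarrow> ((1, 2) \<in> A \<longleftrightarrow> (2, 2) \<in> A))"
      unfolding bip_cuts_2_iff[OF that] I by auto
    also have "\<dots> \<longleftrightarrow> even (\<Sum>x\<in>\<Omega> 2 2. of_bool (x \<in> A) :: nat)"
      unfolding O by (simp add: of_bool_def del: sum_of_bool_eq)
    also have "(\<Sum>x\<in>\<Omega> 2 2. of_bool (x \<in> A) :: nat) = card A"
      using that by (simp add: of_bool_def sum.If_cases Int_absorb1)
    finally show ?thesis .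
  qed
  then show ?thesis using bip_cuts_subset by blast
qed

lemma C2_wr_Sym_subset_Aut: "C2_wr_Sym b \<subseteq> Aut 2 b (C0 2 b)"
proof
  fix \<pi> assume P: "\<pi> \<in> C2_wr_Sym b"
  have perm: "\<pi> permutes \<Omega> 2 b"
    using subgroup.subset[OF subgroup_C2_wr_Sym] P by (auto simp: Sym_def)
  obtain \<sigma> \<tau> where s: "\<sigma> permutes {1..b}" and t: "\<And>j. j \<in> {1..b} \<Longrightarrow> \<tau> j permutes {1..2}"
    and \<pi>: "\<And>i j. \<pi> (i, j) = (if (i, j) \<in> \<Omega> 2 b then (\<tau> (\<sigma> j) i, \<sigma> j) else (i, j))"
    using P unfolding C2_wr_Sym_iff by blast
  have "\<pi> ` A \<in> bip_cuts 2 b" if A: "A \<in> bip_cuts 2 b" for A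
  proof -
    have sub: "A \<subseteq> \<Omega> 2 b" "\<pi> ` A \<subseteq> \<Omega> 2 b"
      using bip_cuts_subset[OF A] permutes_image[OF perm] by auto
    obtain p where p: "\<And>j. j \<in> {1..b} \<Longrightarrow> ((1, j) \<in> A \<longleftrightarrow> (2, j) \<in> A) \<longleftrightarrow> p"
      using A unfolding bip_cuts_2_iff[OF sub(1)] by blast
    have "((1, k) \<in> \<pi> ` A \<longleftrightarrow> (2, k) \<in> \<pi> ` A) \<longleftrightarrow> p" if k: "k \<in> {1..b}" for k
    proof -
      obtain j where j: "j \<in> {1..b}" "k = \<sigma> j"
        using k permutes_image[OF s] by blast
      have im: "(\<tau> k i, k) \<in> \<pi> ` A \<longleftrightarrow> (i, j) \<in> A" if "i \<in> {1..2}" for i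
        using inj_image_mem_iff[OF permutes_inj[OF perm], of "(i, j)" A] that j by (simp add: \<pi>)
      have "\<tau> k 1 \<in> {1..2}" "\<tau> k 2 \<in> {1..2}" "\<tau> k 1 \<noteq> \<tau> k 2"
        using permutes_in_image[OF t[OF k], of 1] permutes_in_image[OF t[OF k], of 2]
          inj_eq[OF permutes_inj[OF t[OF k]], of 1 2] by auto
      then have "\<tau> k 1 = 1 \<and> \<tau> k 2 = 2 \<or> \<tau> k 1 = 2 \<and> \<tau> k 2 = 1"
        by auto
      then show ?thesis using im[of 1] im[of 2] p[OF j(1)] by auto
    qed
    then show ?thesis unfolding bip_cuts_2_iff[OF sub(2)] by (intro exI[of _ p] ballI)
  qed
  then show "\<pi> \<in> Aut 2 b (C0 2 b)" using perm by (simp add: Aut_C0_iff)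
qed

lemma prod_act_apply:
  "(i, j) \<in> \<Omega> a b \<Longrightarrow> prod_act a b (\<sigma>, \<tau>) (i, j) = (\<sigma> i, \<tau> j)"
  by (simp add: prod_act_def perm_restrict_def)

lemma Sym_times_Sym_subset_Aut: "Sym_times_Sym a b \<subseteq> Aut a b (C0 a b)"
proof
  fix \<pi> assume P: "\<pi> \<in> Sym_times_Sym a b"
  have perm: "\<pi> permutes \<Omega> a b"
    using subgroup.subset[OF subgroup_Sym_times_Sym] P by (auto simp: Sym_def)
  obtain \<sigma> \<tau> where s: "\<sigma> permutes {1..a}" and t: "\<tau> permutes {1..b}"
    and \<pi>: "\<pi> = prod_act a b (\<sigma>, \<tau>)"
    using P by (auto simp: Sym_times_Sym_def sym_group_carrier)
  have "\<pi> ` bip_cut a b S T = bip_cut a b (\<sigma> ` S) (\<tau> ` T)" for S T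
  proof (rule Set.set_eqI)
    fix y
    show "y \<in> \<pi> ` bip_cut a b S T \<longleftrightarrow> y \<in> bip_cut a b (\<sigma> ` S) (\<tau> ` T)"
    proof (cases "y \<in> \<Omega> a b")
      case True
      then obtain x where x: "x \<in> \<Omega> a b" "y = \<pi> x" using permutes_image[OF perm] by blast
      obtain i j where ij: "x = (i, j)" by (cases x)
      have "\<sigma> i \<in> {1..a}" "\<tau> j \<in> {1..b}"
        using x(1) permutes_in_image[OF s] permutes_in_image[OF t] unfolding ij mem_\<Omega> by blast+
      then show ?thesis
        unfolding x(2) inj_image_mem_iff[OF permutes_inj[OF perm]]
        using x(1) unfolding ij \<pi>
        by (simp only: prod_act_apply mem_bip_cut mem_\<Omega> inj_image_mem_iff permutes_inj[OF s]
            permutes_inj[OF t])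
    next
      case False
      then show ?thesis
        using permutes_image[OF perm] by (auto simp: bip_cut_def)
    qed
  qed
  then show "\<pi> \<in> Aut a b (C0 a b)"
    using perm unfolding Aut_C0_iff bip_cuts_def by fastforce
qed

abbreviation transpose_act :: "nat \<Rightarrow> nat \<times> nat \<Rightarrow> nat \<times> nat"
  where "transpose_act a \<equiv> perm_restrict (\<lambda>(i, j). (j, i)) (\<Omega> a a)"

lemma transpose_act_involution: "transpose_act a \<circ> transpose_act a = id"
  by (auto simp: fun_eq_iff perm_restrict_def)

lemma transpose_act_in_Aut: "transpose_act a \<in> Aut a a (C0 a a)"
proof -
  have "transpose_act a permutes \<Omega> a a"
    by (rule bij_imp_permutes)
      (auto simp: perm_restrict_def intro!: bij_betwI[where g = "\<lambda>(i, j). (j, i)"])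
  moreover have "transpose_act a ` bip_cut a a S T = bip_cut a a T S" for S T
    by (force simp: perm_restrict_def bip_cut_def)
  ultimately show ?thesis unfolding Aut_C0_iff bip_cuts_def by fastforce
qed

lemma Sym_wr_C2_subset_Aut: "Sym_wr_C2 a \<subseteq> Aut a a (C0 a a)"
  unfolding Sym_wr_C2_def
  by (rule group.generate_subgroup_incl[OF group_Sym])
    (use Sym_times_Sym_subset_Aut transpose_act_in_Aut subgroup_Aut_C0 in auto)

section \<open>Cuts with as many elements as a column\<close>

lemma card_bip_cut:
  assumes "S \<subseteq> {1..a}" "T \<subseteq> {1..b}"
  shows "int (card (bip_cut a b S T)) =
    int (card S) * (int b - 2 * int (card T)) + int a * int (card T)"
proof -
  have fin: "finite S" "finite T" using assms finite_subset by blast+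
  have le: "card S \<le> a" "card T \<le> b"
    using card_mono[OF _ assms(1)] card_mono[OF _ assms(2)] by auto
  have "bip_cut a b S T = S \<times> ({1..b} - T) \<union> ({1..a} - S) \<times> T"
    using assms by (auto simp: bip_cut_def)
  then have "card (bip_cut a b S T) = card (S \<times> ({1..b} - T)) + card (({1..a} - S) \<times> T)"
    using fin by (simp add: card_Un_disjoint Int_def)
  also have "\<dots> = card S * (b - card T) + (a - card S) * card T"
    using assms fin by (simp add: card_cartesian_product card_Diff_subset)
  finally show ?thesis using le by (simp add: of_nat_diff) (simp add: algebra_simps)
qed

text \<open>
  Complementing both sides of the vertex partition does not change the cut, so one may assume that
  \<open>T\<close> contains at most half of the columns; this makes both summands in \<open>card_bip_cut\<close> nonnegative.
\<close>

lemma bip_cutE: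
  assumes "A \<in> bip_cuts a b"
  obtains S T where "A = bip_cut a b S T" "S \<subseteq> {1..a}" "T \<subseteq> {1..b}" "2 * card T \<le> b"
proof -
  obtain S0 T0 where "A = bip_cut a b S0 T0" using assms by (auto simp: bip_cuts_def)
  then have A: "A = bip_cut a b (S0 \<inter> {1..a}) (T0 \<inter> {1..b})"
    "A = bip_cut a b ({1..a} - S0) ({1..b} - T0)"
    by (auto simp: bip_cut_def)
  have "card {1..b} = card (T0 \<inter> {1..b}) + card ({1..b} - T0)"
    by (subst card_Int_Diff[of _ T0]) (simp_all add: Int_commute)
  then consider "2 * card (T0 \<inter> {1..b}) \<le> b" | "2 * card ({1..b} - T0) \<le> b"
    by fastforce
  then show thesis
    by cases (use A that in auto)
qed

lemma bip_cut_card_a: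
  assumes "1 \<le> a" "a \<le> b" "2 < b" "A \<in> bip_cuts a b" "card A = a"
  shows "(\<exists>j\<in>{1..b}. A = {1..a} \<times> {j}) \<or> a = b \<and> (\<exists>i\<in>{1..a}. A = {i} \<times> {1..b})"
proof -
  obtain S T where A: "A = bip_cut a b S T" and ST: "S \<subseteq> {1..a}" "T \<subseteq> {1..b}"
    and half: "2 * card T \<le> b"
    using bip_cutE[OF assms(4)] by blast
  have eq: "int (card S) * (int b - 2 * int (card T)) + int a * int (card T) = int a"
    using card_bip_cut[OF ST] assms(5) A by simp
  consider "card T = 0" | "card T = 1" | "2 \<le> card T" by linarith
  then show ?thesis
  proof cases
    case 1
    then have T: "T = {}" using ST(2) finite_subset by fastforce
    have sb: "card S * b = a" using eq 1 by (simp flip: of_nat_mult)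
    then have "card S \<noteq> 0" "\<not> 2 \<le> card S"
      using assms(1,2) mult_le_mono1[of 2 "card S" b] by auto
    then have s: "card S = 1" by linarith
    then obtain i where "S = {i}" by (auto simp: card_1_singleton_iff)
    then show ?thesis using A T ST sb s by (auto simp: bip_cut_def)
  next
    case 2
    then obtain j where T: "T = {j}" by (auto simp: card_1_singleton_iff)
    have "int (card S) * (int b - 2) = 0" using eq 2 by simp
    then have "S = {}" using assms(3) ST(1) finite_subset by fastforce
    then show ?thesis using A T ST by (auto simp: bip_cut_def)
  next
    case 3
    have "0 \<le> int (card S) * (int b - 2 * int (card T))" using half by simp
    moreover have "int a * 2 \<le> int a * int (card T)" using 3 by (intro mult_left_mono) auto
    ultimately show ?thesis using eq assms(1) by linarith
  qed
qed

text \<open>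
  By the previous lemma each single column is mapped to a column or to a row. Mixed behaviour is
  impossible: a row meets every column, whereas the images of two different
  columns are disjoint.
\<close>

lemma column_images:
  assumes "1 \<le> a" "a \<le> b" "2 < b" "\<pi> \<in> Aut a b (C0 a b)"
  shows "(\<forall>x\<in>\<Omega> a b. \<forall>y\<in>\<Omega> a b. snd x = snd y \<longrightarrow> snd (\<pi> x) = snd (\<pi> y)) \<or>
    a = b \<and> (\<forall>x\<in>\<Omega> a b. \<forall>y\<in>\<Omega> a b. snd x = snd y \<longrightarrow> fst (\<pi> x) = fst (\<pi> y))"
proof -
  have perm: "\<pi> permutes \<Omega> a b" and pres: "\<And>A. A \<in> bip_cuts a b \<Longrightarrow> \<pi> ` A \<in> bip_cuts a b"
    using assms(4) by (auto simp: Aut_C0_iff)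
  have cols: "(\<exists>k\<in>{1..b}. \<pi> ` ({1..a} \<times> {j}) = {1..a} \<times> {k}) \<or>
      a = b \<and> (\<exists>i\<in>{1..a}. \<pi> ` ({1..a} \<times> {j}) = {i} \<times> {1..b})"
    if "j \<in> {1..b}" for j
    using that assms(1-3) pres column_in_bip_cuts
    by (intro bip_cut_card_a) (simp_all add: card_image permutes_inj_on[OF perm])
  show ?thesis
  proof (cases "\<exists>j\<in>{1..b}. \<exists>i\<in>{1..a}. a = b \<and> \<pi> ` ({1..a} \<times> {j}) = {i} \<times> {1..b}")
    case True
    then obtain j i where ji: "j \<in> {1..b}" "i \<in> {1..a}" "a = b"
      "\<pi> ` ({1..a} \<times> {j}) = {i} \<times> {1..b}" by blast
    have rows: "\<exists>i'\<in>{1..a}. \<pi> ` ({1..a} \<times> {j'}) = {i'} \<times> {1..b}" if j': "j' \<in> {1..b}" for j'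
    proof (rule ccontr)
      assume no: "\<not> ?thesis"
      then obtain k where k: "k \<in> {1..b}" "\<pi> ` ({1..a} \<times> {j'}) = {1..a} \<times> {k}"
        using cols[OF j'] by blast
      have "j \<noteq> j'" using no ji by blast
      then have "\<pi> ` ({1..a} \<times> {j}) \<inter> \<pi> ` ({1..a} \<times> {j'}) = {}"
        by (subst image_Int[symmetric]) (auto intro: permutes_inj[OF perm])
      moreover have "(i, k) \<in> \<pi> ` ({1..a} \<times> {j}) \<inter> \<pi> ` ({1..a} \<times> {j'})"
        using ji k by auto
      ultimately show False by blast
    qed
    have "fst (\<pi> x) = fst (\<pi> y)" if xy: "x \<in> \<Omega> a b" "y \<in> \<Omega> a b" "snd x = snd y" for x y
    proof -
      have in_col: "x \<in> {1..a} \<times> {snd x}" "y \<in> {1..a} \<times> {snd x}" "snd x \<in> {1..b}"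
        using xy by (auto simp: \<Omega>_def)
      obtain i' where i': "\<pi> ` ({1..a} \<times> {snd x}) = {i'} \<times> {1..b}"
        using rows[OF in_col(3)] by blast
      show ?thesis
        using imageI[OF in_col(1), of \<pi>] imageI[OF in_col(2), of \<pi>] unfolding i'
        by (simp only: mem_Times_iff singleton_iff)
    qed
    then show ?thesis using ji(3) by blast
  next
    case False
    have "snd (\<pi> x) = snd (\<pi> y)" if xy: "x \<in> \<Omega> a b" "y \<in> \<Omega> a b" "snd x = snd y" for x y
    proof -
      have in_col: "x \<in> {1..a} \<times> {snd x}" "y \<in> {1..a} \<times> {snd x}" "snd x \<in> {1..b}"
        using xy by (auto simp: \<Omega>_def)
      obtain k where k: "\<pi> ` ({1..a} \<times> {snd x}) = {1..a} \<times> {k}"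
        using cols[OF in_col(3)] False in_col(3) by blast
      show ?thesis
        using imageI[OF in_col(1), of \<pi>] imageI[OF in_col(2), of \<pi>] unfolding k
        by (simp only: mem_Times_iff singleton_iff)
    qed
    then show ?thesis by blast
  qed
qed

section \<open>Automorphisms that permute the columns\<close>

text \<open>
  A permutation that respects the fibres of \<open>f\<close> permutes them. For \<open>f = snd\<close> and \<open>f = fst\<close> the
  fibres are the columns and the rows.
\<close>

lemma induced_permutation:
  assumes "\<pi> permutes X" "f ` X = Y" "finite Y"
    and "\<And>x y. x \<in> X \<Longrightarrow> y \<in> X \<Longrightarrow> f x = f y \<Longrightarrow> f (\<pi> x) = f (\<pi> y)"
  obtains \<sigma> where "\<sigma> permutes Y" "\<And>x. x \<in> X \<Longrightarrow> f (\<pi> x) = \<sigma> (f x)"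
proof -
  define \<sigma> where "\<sigma> = restrict_id (\<lambda>y. f (\<pi> (inv_into X f y))) Y"
  have \<sigma>: "f (\<pi> x) = \<sigma> (f x)" if "x \<in> X" for x
    using that assms(2) assms(4)[of x "inv_into X f (f x)"]
    by (auto simp: \<sigma>_def restrict_id_def inv_into_into f_inv_into_f)
  have "\<sigma> ` f ` X = f ` \<pi> ` X"
    unfolding image_image by (rule image_cong) (simp_all add: \<sigma>)
  then have "\<sigma> ` Y = Y" by (simp add: permutes_image[OF assms(1)] assms(2))
  then have "bij_betw \<sigma> Y Y"
    using assms(3) by (simp add: bij_betw_def finite_surj_inj)
  then have "\<sigma> permutes Y"
    by (rule bij_imp_permutes) (simp add: \<sigma>_def restrict_id_def)
  then show thesis using \<sigma> that by blast
qed

lemma fst_image_\<Omega>: "1 \<le> b \<Longrightarrow> fst ` \<Omega> a b = {1..a}"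
  and snd_image_\<Omega>: "1 \<le> a \<Longrightarrow> snd ` \<Omega> a b = {1..b}"
  by (auto simp: \<Omega>_def)

lemma columns_to_columns_in_C2_wr_Sym:
  assumes perm: "\<pi> permutes \<Omega> 2 b"
    and cols: "\<And>x y. x \<in> \<Omega> 2 b \<Longrightarrow> y \<in> \<Omega> 2 b \<Longrightarrow> snd x = snd y \<Longrightarrow> snd (\<pi> x) = snd (\<pi> y)"
  shows "\<pi> \<in> C2_wr_Sym b"
proof -
  obtain \<sigma> where s: "\<sigma> permutes {1..b}" and \<sigma>: "\<And>x. x \<in> \<Omega> 2 b \<Longrightarrow> snd (\<pi> x) = \<sigma> (snd x)"
    by (rule induced_permutation[OF perm snd_image_\<Omega> _ cols]) simp_all
  define \<tau> where "\<tau> = (\<lambda>k. restrict_id (\<lambda>i. fst (\<pi> (i, inv_into UNIV \<sigma> k))) {1..2})"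
  have "\<tau> k permutes {1..2}" if k: "k \<in> {1..b}" for k
  proof -
    define j where "j = inv_into UNIV \<sigma> k"
    have j: "j \<in> {1..b}"
      unfolding j_def using permutes_in_image[OF permutes_inv[OF s]] k by blast
    have "inj_on (\<lambda>i. fst (\<pi> (i, j))) {1..2}"
    proof (rule inj_onI)
      fix i i' assume i: "i \<in> {1..2}" "i' \<in> {1..2}" "fst (\<pi> (i, j)) = fst (\<pi> (i', j))"
      then have "\<pi> (i, j) = \<pi> (i', j)"
        using \<sigma>[of "(i, j)"] \<sigma>[of "(i', j)"] j by (simp add: prod_eq_iff)
      then show "i = i'" using inj_eq[OF permutes_inj[OF perm]] by blast
    qed
    moreover have "(\<lambda>i. fst (\<pi> (i, j))) ` {1..2} \<subseteq> {1..2}"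
    proof (rule image_subsetI)
      fix i :: nat assume "i \<in> {1..2}"
      then have "\<pi> (i, j) \<in> \<Omega> 2 b" using j permutes_in_image[OF perm] by simp
      then show "fst (\<pi> (i, j)) \<in> {1..2}" by (auto simp: \<Omega>_def)
    qed
    ultimately have "bij_betw (\<lambda>i. fst (\<pi> (i, j))) {1..2} {1..2}"
      by (simp add: bij_betw_def endo_inj_surj)
    then show ?thesis
      unfolding \<tau>_def j_def[symmetric]
      by (intro bij_imp_permutes bij_betw_restrict_id) (auto simp: restrict_id_def)
  qed
  moreover have "\<pi> (i, j) = (if (i, j) \<in> \<Omega> 2 b then (\<tau> (\<sigma> j) i, \<sigma> j) else (i, j))" for i j
  proof (cases "(i, j) \<in> \<Omega> 2 b")
    case True
    then show ?thesis
      using \<sigma>[OF True] by (simp add: \<tau>_def restrict_id_def permutes_inverses[OF s] prod_eq_iff)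
  next
    case False
    then show ?thesis unfolding permutes_not_in[OF perm False] by (simp only: if_False)
  qed
  ultimately show ?thesis unfolding C2_wr_Sym_iff using s by blast
qed

text \<open>
  If two points of the image of a row had different row indices \<open>i1\<close> and \<open>i2\<close>, then the image
  would meet the column of the first only in row \<open>i1\<close> and that of the second only in row \<open>i2\<close>.
  In a cut any two columns are equal or complementary as sets of rows, but these two differ in row
  \<open>i1\<close> and agree in any third row.
\<close>

lemma rows_to_rows:
  assumes a: "2 < a" and Aut: "\<pi> \<in> Aut a b (C0 a b)"
    and s: "\<sigma> permutes {1..b}" and \<sigma>: "\<And>x. x \<in> \<Omega> a b \<Longrightarrow> snd (\<pi> x) = \<sigma> (snd x)"
    and x: "x \<in> \<Omega> a b" and y: "y \<in> \<Omega> a b" and xy: "fst x = fst y"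
  shows "fst (\<pi> x) = fst (\<pi> y)"
proof (rule ccontr)
  assume neq: "fst (\<pi> x) \<noteq> fst (\<pi> y)"
  have perm: "\<pi> permutes \<Omega> a b" using Aut by (simp add: Aut_C0_iff)
  define R where "R = {fst x} \<times> {1..b}"
  have R: "R \<in> bip_cuts a b" "R \<subseteq> \<Omega> a b" "x \<in> R" "y \<in> R"
    using x y xy row_in_bip_cuts[of "fst x" a b] by (auto simp: R_def \<Omega>_def)
  obtain S T where ST: "\<pi> ` R = bip_cut a b S T"
    using Aut R(1) unfolding Aut_C0_iff bip_cuts_def by blast
  have once: "i = i'" if in_image: "(i, k) \<in> \<pi> ` R" "(i', k) \<in> \<pi> ` R" for i i' k
  proof -
    obtain z z' where z: "z \<in> R" "z' \<in> R" "(i, k) = \<pi> z" "(i', k) = \<pi> z'"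
      using in_image by blast
    have "snd (\<pi> z) = snd (\<pi> z')" by (simp flip: z(3,4))
    then have "\<sigma> (snd z) = \<sigma> (snd z')" using \<sigma>[of z] \<sigma>[of z'] subsetD[OF R(2)] z(1,2) by simp
    then have "snd z = snd z'" using inj_eq[OF permutes_inj[OF s]] by blast
    then have "z = z'" using z(1,2) by (auto simp: R_def)
    then show ?thesis using z(3,4) by (metis prod.inject)
  qed
  obtain i1 k1 where p1: "\<pi> x = (i1, k1)" by (cases "\<pi> x")
  obtain i2 k2 where p2: "\<pi> y = (i2, k2)" by (cases "\<pi> y")
  have mem: "(i1, k1) \<in> \<pi> ` R" "(i2, k2) \<in> \<pi> ` R"
    using imageI[OF R(3), of \<pi>] imageI[OF R(4), of \<pi>] p1 p2 by simp_all
  have i12: "i1 \<noteq> i2" using neq p1 p2 by simp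
  obtain i3 where i3: "i3 \<in> {1..a}" "i3 \<noteq> i1" "i3 \<noteq> i2"
  proof -
    have "\<exists>i3\<in>{1, 2, 3 :: nat}. i3 \<noteq> i1 \<and> i3 \<noteq> i2" by auto
    moreover have "{1, 2, 3} \<subseteq> {1..a}" using a by auto
    ultimately show thesis using that by blast
  qed
  have "(i2, k1) \<notin> \<pi> ` R" "(i3, k1) \<notin> \<pi> ` R" "(i1, k2) \<notin> \<pi> ` R" "(i3, k2) \<notin> \<pi> ` R"
    using once mem i12 i3 by metis+
  then show False using mem i3(1) unfolding ST mem_bip_cut by blast
qed

lemma columns_to_columns_in_Sym_times_Sym:
  assumes a: "2 < a" and b: "1 \<le> b" and Aut: "\<pi> \<in> Aut a b (C0 a b)"
    and cols: "\<And>x y. x \<in> \<Omega> a b \<Longrightarrow> y \<in> \<Omega> a b \<Longrightarrow> snd x = snd y \<Longrightarrow> snd (\<pi> x) = snd (\<pi> y)"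
  shows "\<pi> \<in> Sym_times_Sym a b"
proof -
  have perm: "\<pi> permutes \<Omega> a b" using Aut by (simp add: Aut_C0_iff)
  obtain \<tau> where t: "\<tau> permutes {1..b}" and \<tau>: "\<And>x. x \<in> \<Omega> a b \<Longrightarrow> snd (\<pi> x) = \<tau> (snd x)"
    by (rule induced_permutation[OF perm snd_image_\<Omega> _ cols]) (use a in simp_all)
  obtain \<sigma> where s: "\<sigma> permutes {1..a}" and \<sigma>: "\<And>x. x \<in> \<Omega> a b \<Longrightarrow> fst (\<pi> x) = \<sigma> (fst x)"
    by (rule induced_permutation[OF perm fst_image_\<Omega>[OF b] _ rows_to_rows[OF a Aut t \<tau>]]) simp_all
  have "\<pi> = prod_act a b (\<sigma>, \<tau>)"
  proof
    fix x
    show "\<pi> x = prod_act a b (\<sigma>, \<tau>) x"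
      using \<sigma>[of x] \<tau>[of x] permutes_not_in[OF perm, of x]
      by (auto simp: prod_act_def perm_restrict_def prod_eq_iff case_prod_beta)
  qed
  then show ?thesis
    using s t by (auto simp: Sym_times_Sym_def sym_group_carrier)
qed

lemma Aut_subset_Sym_wr_C2:
  assumes a: "2 < a"
  shows "Aut a a (C0 a a) \<subseteq> Sym_wr_C2 a"
proof
  fix \<pi> assume Aut: "\<pi> \<in> Aut a a (C0 a a)"
  have gens: "Sym_times_Sym a a \<subseteq> Sym_wr_C2 a" "transpose_act a \<in> Sym_wr_C2 a"
    unfolding Sym_wr_C2_def by (auto intro: generate.incl)
  consider
    (cols) "\<forall>x\<in>\<Omega> a a. \<forall>y\<in>\<Omega> a a. snd x = snd y \<longrightarrow> snd (\<pi> x) = snd (\<pi> y)" |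
    (rows) "\<forall>x\<in>\<Omega> a a. \<forall>y\<in>\<Omega> a a. snd x = snd y \<longrightarrow> fst (\<pi> x) = fst (\<pi> y)"
    using column_images[of a a \<pi>] Aut a by fastforce
  then show "\<pi> \<in> Sym_wr_C2 a"
  proof cases
    case cols
    then have cols': "snd (\<pi> x) = snd (\<pi> y)"
      if "x \<in> \<Omega> a a" "y \<in> \<Omega> a a" "snd x = snd y" for x y
      using that by blast
    have "\<pi> \<in> Sym_times_Sym a a"
      by (rule columns_to_columns_in_Sym_times_Sym[OF a _ Aut cols']) (use a in linarith)
    then show ?thesis using gens by blast
  next
    case rows
    have perm: "\<pi> permutes \<Omega> a a" using Aut by (simp add: Aut_C0_iff)
    define \<rho> where "\<rho> = transpose_act a \<circ> \<pi>"
    have Aut': "\<rho> \<in> Aut a a (C0 a a)"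
      using subgroup.m_closed[OF subgroup_Aut_C0 transpose_act_in_Aut Aut]
      by (simp add: \<rho>_def Sym_def)
    have snd_\<rho>: "snd (\<rho> x) = fst (\<pi> x)" if "x \<in> \<Omega> a a" for x
      using that permutes_in_image[OF perm, of x]
      by (simp add: \<rho>_def perm_restrict_def case_prod_beta)
    have cols': "snd (\<rho> x) = snd (\<rho> y)"
      if "x \<in> \<Omega> a a" "y \<in> \<Omega> a a" "snd x = snd y" for x y
      unfolding snd_\<rho>[OF that(1)] snd_\<rho>[OF that(2)] using that rows by blast
    have "\<rho> \<in> Sym_times_Sym a a"
      by (rule columns_to_columns_in_Sym_times_Sym[OF a _ Aut' cols']) (use a in linarith)
    then have "transpose_act a \<circ> \<rho> \<in> Sym_wr_C2 a"
      using subgroup.m_closed[OF subgroup_Sym_wr_C2 gens(2), of \<rho>] gens(1)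
      by (auto simp: Sym_def)
    moreover have "transpose_act a \<circ> \<rho> = \<pi>"
      unfolding \<rho>_def comp_assoc[symmetric] transpose_act_involution by (rule id_comp)
    ultimately show ?thesis by (simp only:)
  qed
qed

section \<open>The automorphism groups\<close>

lemma Sym_iso_of_bij_betw:
  assumes "bij_betw f A B"
  shows "Sym A \<cong> Sym B"
proof (rule is_isoI, rule isoI)
  have inj: "inj_on f A" by (rule bij_betw_imp_inj_on[OF assms])
  have inv: "bij_betw (inv_into A f) B A" by (rule bij_betw_inv_into[OF assms])
  show "map_permutation A f \<in> hom (Sym A) (Sym B)"
    by (rule homI) (auto simp: Sym_def map_permutation_permutes[OF assms]
      map_permutation_compose'[OF inj])
  show "bij_betw (map_permutation A f) (carrier (Sym A)) (carrier (Sym B))"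
    by (rule bij_betwI[where g = "map_permutation B (inv_into A f)"])
      (auto simp: Sym_def map_permutation_permutes[OF assms] map_permutation_permutes[OF inv]
        map_permutation_compose_inv[OF assms] map_permutation_compose_inv[OF inv]
        inj bij_betw_inv_into_right[OF assms])
qed

lemma Sym_iso_sym_group:
  assumes "finite A" "card A = n"
  shows "Sym A \<cong> sym_group n"
proof -
  obtain f where "bij_betw f A {1..n}"
    using finite_same_card_bij[of A "{1..n}"] assms by auto
  then have "Sym A \<cong> Sym {1..n}" by (rule Sym_iso_of_bij_betw)
  then show ?thesis by (simp add: Sym_def sym_group_def)
qed

theorem proposition3p2:
  fixes a b :: nat
  assumes "1 \<le> a" and "a \<le> b"
  shows "(a = 1 \<longrightarrow>
            Aut a b (C0 a b) = carrier (Sym (\<Omega> a b)) \<and> Sym (\<Omega> a b) \<cong> sym_group b) \<and>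
         (a = 2 \<and> b = 2 \<longrightarrow>
            Aut a b (C0 a b) = carrier (Sym (\<Omega> a b)) \<and> Sym (\<Omega> a b) \<cong> sym_group 4) \<and>
         (a = 2 \<and> a < b \<longrightarrow> Aut a b (C0 a b) = C2_wr_Sym b) \<and>
         (2 < a \<and> a = b \<longrightarrow> Aut a b (C0 a b) = Sym_wr_C2 a) \<and>
         (2 < a \<and> a < b \<longrightarrow> Aut a b (C0 a b) = Sym_times_Sym a b)"
proof (intro conjI impI)
  have iso: "Sym (\<Omega> a b) \<cong> sym_group (a * b)"
    by (rule Sym_iso_sym_group) (simp_all add: \<Omega>_def)
  {
    assume a: "a = 1"
    show "Aut a b (C0 a b) = carrier (Sym (\<Omega> a b))"
      unfolding a by (auto simp only: Aut_C0_iff bip_cuts_1 Sym_def)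
        (auto simp only: Pow_iff partial_object.simps mem_Collect_eq dest: permutes_image)
    show "Sym (\<Omega> a b) \<cong> sym_group b" using iso a by simp
  next
    assume ab: "a = 2 \<and> b = 2"
    have "\<pi> ` A \<in> bip_cuts 2 2" if "\<pi> permutes \<Omega> 2 2" "A \<in> bip_cuts 2 2" for \<pi> A
      using that permutes_image[OF that(1)]
      by (auto simp: bip_cuts_2_2 card_image permutes_inj_on)
    then show "Aut a b (C0 a b) = carrier (Sym (\<Omega> a b))"
      using ab by (auto simp: Aut_C0_iff Sym_def)
    show "Sym (\<Omega> a b) \<cong> sym_group 4" using iso ab by simp
  next
    assume a: "a = 2 \<and> a < b"
    have "Aut 2 b (C0 2 b) \<subseteq> C2_wr_Sym b"
    proof
      have bounds: "1 \<le> (2 :: nat)" "2 \<le> b" "2 < b" using a by auto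
      fix \<pi> assume Aut: "\<pi> \<in> Aut 2 b (C0 2 b)"
      then have perm: "\<pi> permutes \<Omega> 2 b" by (simp add: Aut_C0_iff)
      have "snd (\<pi> x) = snd (\<pi> y)" if "x \<in> \<Omega> 2 b" "y \<in> \<Omega> 2 b" "snd x = snd y" for x y
        using column_images[OF bounds Aut] a that by blast
      from columns_to_columns_in_C2_wr_Sym[OF perm this] show "\<pi> \<in> C2_wr_Sym b" .
    qed
    then show "Aut a b (C0 a b) = C2_wr_Sym b" using a C2_wr_Sym_subset_Aut by blast
  next
    assume "2 < a \<and> a = b"
    then show "Aut a b (C0 a b) = Sym_wr_C2 a"
      using Aut_subset_Sym_wr_C2 Sym_wr_C2_subset_Aut by blast
  next
    assume a: "2 < a \<and> a < b"
    have "Aut a b (C0 a b) \<subseteq> Sym_times_Sym a b"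
    proof
      fix \<pi> assume Aut: "\<pi> \<in> Aut a b (C0 a b)"
      have bounds: "1 \<le> b" "2 < a" "2 < b" using a by auto
      have "snd (\<pi> x) = snd (\<pi> y)" if "x \<in> \<Omega> a b" "y \<in> \<Omega> a b" "snd x = snd y" for x y
        using column_images[OF assms bounds(3) Aut] a that by blast
      from columns_to_columns_in_Sym_times_Sym[OF bounds(2,1) Aut this]
      show "\<pi> \<in> Sym_times_Sym a b" .
    qed
    then show "Aut a b (C0 a b) = Sym_times_Sym a b" using Sym_times_Sym_subset_Aut by blast
  }
qed

end
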